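(* Let $(\mathfrak g,d_{\mathfrak g})$ be a differential 3-Lie algebra with weight $\lambda$ and $(V,\rho,d_V)$ a representation of it. Let $\psi:\wedge^3\mathfrak g\to V$ be a skew-symmetric trilinear map and $\chi:\mathfrak g\to V$ a linear map. Define on the vector space $\mathfrak g\oplus V$ $$[x+a,y+b,z+c]_\psi=[x,y,z]+\psi(x,y,z)+\rho(x,y)c+\rho(y,z)a+\rho(z,x)b,$$ $$d_\chi(x+a)=d_{\mathfrak g}(x)+d_V(a)+\chi(x)$$ for $x,y,z\in\mathfrak g$, $a,b,c\in V$. Then $(\mathfrak g\oplus V,[\cdot,\cdot,\cdot]_\psi,d_\chi)$ is a differential 3-Lie algebra with weight $\lambda$ if and only if $(\psi,\chi)$ is a 2-cocycle of $(\mathfrak g,d_{\mathfrak g})$ with coefficients in the representation $(V,\rho,d_V)$.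
   Context: $k$ is a field of characteristic 0; all vector spaces are over $k$. A 3-Lie algebra is a vector space $\mathfrak g$ with a skew-symmetric trilinear bracket satisfying $[x_1,x_2,[y_1,y_2,y_3]]=[[x_1,x_2,y_1],y_2,y_3]+[y_1,[x_1,x_2,y_2],y_3]+[y_1,y_2,[x_1,x_2,y_3]]$. A differential 3-Lie algebra with weight $\lambda$ is a 3-Lie algebra with a linear map $d=d_{\mathfrak g}:\mathfrak g\to\mathfrak g$ such that $d[x_1,x_2,x_3]=[dx_1,x_2,x_3]+[x_1,dx_2,x_3]+[x_1,x_2,dx_3]+\lambda[dx_1,dx_2,x_3]+\lambda[x_1,dx_2,dx_3]+\lambda[dx_1,x_2,dx_3]+\lambda^2[dx_1,dx_2,dx_3]$. A representation of a 3-Lie algebra $\mathfrak g$ is a vector space $V$ with a skew-symmetric bilinear map $\rho:\mathfrak g\wedge\mathfrak g\to gl(V)$ such that $\rho(x_1,x_2)\rho(x_3,x_4)=\rho([x_1,x_2,x_3],x_4)+\rho(x_3,[x_1,x_2,x_4])+\rho(x_3,x_4)\rho(x_1,x_2)$ and $\rho(x_1,[x_2,x_3,x_4])=\rho(x_3,x_4)\rho(x_1,x_2)-\rho(x_2,x_4)\rho(x_1,x_3)+\rho(x_2,x_3)\rho(x_1,x_4)$. A representation $(V,\rho,d_V)$ of $(\mathfrak g,d)$ has in addition a linear $d_V:V\to V$ with $d_V\rho(x_1,x_2)=\rho(dx_1,x_2)+\rho(x_1,dx_2)+\lambda\rho(dx_1,dx_2)+\rho(x_1,x_2)d_V+\lambda(\rho(dx_1,x_2)+\rho(x_1,dx_2)+\lambda\rho(dx_1,dx_2))d_V$.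 Put $\hat\rho(x,y)=\rho(x,y)+\lambda(\rho(dx,y)+\rho(x,dy)+\lambda\rho(dx,dy))$. For $X=x_1\wedge x_2,Y=y_1\wedge y_2\in\wedge^2\mathfrak g$ put $[X,Y]_F=y_1\wedge[x_1,x_2,y_2]+[x_1,x_2,y_1]\wedge y_2$, $[X,z]=[x_1,x_2,z]$, $\rho(X)=\rho(x_1,x_2)$, and $f(X,z)=f(x_1,x_2,z)$. A 2-cochain is a pair $(f,g)$ with $f:\wedge^3\mathfrak g\to V$ and $g:\mathfrak g\to V$ linear; it is a 2-cocycle if $\partial f=0$ and $\partial_\lambda g+\delta f=0$, where, for $X_i=x_i\wedge y_i$, $(\partial f)(X_1,X_2,z)=-f([X_1,X_2]_F,z)-f(X_2,[X_1,z])+f(X_1,[X_2,z])+\rho(X_1)f(X_2,z)-\rho(X_2)f(X_1,z)-\rho(y_2,z)f(X_1,x_2)-\rho(z,x_2)f(X_1,y_2)$, $(\partial_\lambda g)(x,y,z)=-g([x,y,z])+\hat\rho(x,y)g(z)+\hat\rho(y,z)g(x)+\hat\rho(z,x)g(y)$, $(\delta f)(x,y,z)=f(dx,y,z)+f(x,dy,z)+f(x,y,dz)+\lambda(f(dx,dy,z)+f(x,dy,dz)+f(dx,y,dz))+\lambda^2f(dx,dy,dz)-d_Vf(x,y,z)$. *)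

theory Defs
  imports "HOL-Analysis.Product_Vector"
begin

text \<open>
  A vector space over \<open>'k\<close> is a type \<open>'g :: ab_group_add\<close> together with a scalar
  multiplication satisfying \<^locale>\<open>vector_space\<close>.  Linear maps out of the exterior
  square and the exterior cube are represented by the corresponding skew-symmetric
  multilinear maps; over a field of characteristic 0 skew-symmetric and alternating
  maps coincide.
\<close>

definition bilinear_on ::
  "('k::field \<Rightarrow> 'g::ab_group_add \<Rightarrow> 'g) \<Rightarrow> ('k \<Rightarrow> 'v::ab_group_add \<Rightarrow> 'v) \<Rightarrow>
   ('g \<Rightarrow> 'g \<Rightarrow> 'v) \<Rightarrow> bool"
  where "bilinear_on s t f \<longleftrightarrow>
    (\<forall>y. Vector_Spaces.linear s t (\<lambda>x. f x y)) \<and>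
    (\<forall>x. Vector_Spaces.linear s t (\<lambda>y. f x y))"

definition trilinear_on ::
  "('k::field \<Rightarrow> 'g::ab_group_add \<Rightarrow> 'g) \<Rightarrow> ('k \<Rightarrow> 'v::ab_group_add \<Rightarrow> 'v) \<Rightarrow>
   ('g \<Rightarrow> 'g \<Rightarrow> 'g \<Rightarrow> 'v) \<Rightarrow> bool"
  where "trilinear_on s t f \<longleftrightarrow>
    (\<forall>y z. Vector_Spaces.linear s t (\<lambda>x. f x y z)) \<and>
    (\<forall>x z. Vector_Spaces.linear s t (\<lambda>y. f x y z)) \<and>
    (\<forall>x y. Vector_Spaces.linear s t (\<lambda>z. f x y z))"

text \<open>The two adjacent transpositions generate the symmetric group on three arguments.\<close>

definition skew_symmetric3 :: "('g \<Rightarrow> 'g \<Rightarrow> 'g \<Rightarrow> 'v::ab_group_add) \<Rightarrow> bool"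
  where "skew_symmetric3 f \<longleftrightarrow>
    (\<forall>x y z. f y x z = - f x y z) \<and> (\<forall>x y z. f x z y = - f x y z)"

locale three_lie_algebra = vector_space sg
  for sg :: "'k::field_char_0 \<Rightarrow> 'g::ab_group_add \<Rightarrow> 'g" +
  fixes br :: "'g \<Rightarrow> 'g \<Rightarrow> 'g \<Rightarrow> 'g"
  assumes br_trilinear: "trilinear_on sg sg br"
    and br_skew: "skew_symmetric3 br"
    and fundamental_identity:
      "br x1 x2 (br y1 y2 y3) =
         br (br x1 x2 y1) y2 y3 + br y1 (br x1 x2 y2) y3 + br y1 y2 (br x1 x2 y3)"

locale differential_three_lie_algebra = three_lie_algebra sg br
  for sg :: "'k::field_char_0 \<Rightarrow> 'g::ab_group_add \<Rightarrow> 'g"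
    and br :: "'g \<Rightarrow> 'g \<Rightarrow> 'g \<Rightarrow> 'g" +
  fixes lam :: 'k and d :: "'g \<Rightarrow> 'g"
  assumes d_linear: "Vector_Spaces.linear sg sg d"
    and d_bracket:
      "d (br x1 x2 x3) =
         br (d x1) x2 x3 + br x1 (d x2) x3 + br x1 x2 (d x3)
         + sg lam (br (d x1) (d x2) x3) + sg lam (br x1 (d x2) (d x3))
         + sg lam (br (d x1) x2 (d x3))
         + sg (lam ^ 2) (br (d x1) (d x2) (d x3))"

locale three_lie_representation = three_lie_algebra sg br + V: vector_space sv
  for sg :: "'k::field_char_0 \<Rightarrow> 'g::ab_group_add \<Rightarrow> 'g"
    and br :: "'g \<Rightarrow> 'g \<Rightarrow> 'g \<Rightarrow> 'g"
    and sv :: "'k \<Rightarrow> 'v::ab_group_add \<Rightarrow> 'v" +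
  fixes rho :: "'g \<Rightarrow> 'g \<Rightarrow> 'v \<Rightarrow> 'v"
  assumes rho_linear: "Vector_Spaces.linear sv sv (rho x y)"
    and rho_bilinear: "bilinear_on sg sv (\<lambda>x y. rho x y v)"
    and rho_skew: "rho y x v = - rho x y v"
    and rho_rho:
      "rho x1 x2 (rho x3 x4 v) =
         rho (br x1 x2 x3) x4 v + rho x3 (br x1 x2 x4) v + rho x3 x4 (rho x1 x2 v)"
    and rho_br:
      "rho x1 (br x2 x3 x4) v =
         rho x3 x4 (rho x1 x2 v) - rho x2 x4 (rho x1 x3 v) + rho x2 x3 (rho x1 x4 v)"

locale differential_three_lie_representation =
  differential_three_lie_algebra sg br lam d + three_lie_representation sg br sv rho
  for sg :: "'k::field_char_0 \<Rightarrow> 'g::ab_group_add \<Rightarrow> 'g"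
    and br :: "'g \<Rightarrow> 'g \<Rightarrow> 'g \<Rightarrow> 'g"
    and lam :: 'k and d :: "'g \<Rightarrow> 'g"
    and sv :: "'k \<Rightarrow> 'v::ab_group_add \<Rightarrow> 'v"
    and rho :: "'g \<Rightarrow> 'g \<Rightarrow> 'v \<Rightarrow> 'v" +
  fixes dV :: "'v \<Rightarrow> 'v"
  assumes dV_linear: "Vector_Spaces.linear sv sv dV"
    and dV_rho:
      "dV (rho x1 x2 v) =
         rho (d x1) x2 v + rho x1 (d x2) v + sv lam (rho (d x1) (d x2) v)
         + rho x1 x2 (dV v)
         + sv lam (rho (d x1) x2 (dV v) + rho x1 (d x2) (dV v)
                   + sv lam (rho (d x1) (d x2) (dV v)))"

definition rho_hat ::
  "'k::field_char_0 \<Rightarrow> ('g \<Rightarrow> 'g) \<Rightarrow> ('k \<Rightarrow> 'v::ab_group_add \<Rightarrow> 'v) \<Rightarrow>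
   ('g \<Rightarrow> 'g \<Rightarrow> 'v \<Rightarrow> 'v) \<Rightarrow> 'g \<Rightarrow> 'g \<Rightarrow> 'v \<Rightarrow> 'v"
  where "rho_hat lam d sv rho x y v =
    rho x y v + sv lam (rho (d x) y v + rho x (d y) v + sv lam (rho (d x) (d y) v))"

text \<open>
  The coboundary of \<open>f\<close> evaluated at \<open>X1 = x1 \<and> y1\<close>, \<open>X2 = x2 \<and> y2\<close> and \<open>z\<close>.
  The first two summands are the value of \<open>- f\<close> at \<open>([X1, X2]\<^sub>F, z)\<close>, where
  \<open>[X1, X2]\<^sub>F = x2 \<and> [x1, y1, y2] + [x1, y1, x2] \<and> y2\<close>.  Decomposable bivectors
  span the exterior square, so vanishing at all of these arguments is vanishing of
  the coboundary.
\<close>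

definition coboundary ::
  "('g \<Rightarrow> 'g \<Rightarrow> 'g \<Rightarrow> 'g) \<Rightarrow> ('g \<Rightarrow> 'g \<Rightarrow> 'v \<Rightarrow> 'v::ab_group_add) \<Rightarrow>
   ('g \<Rightarrow> 'g \<Rightarrow> 'g \<Rightarrow> 'v) \<Rightarrow> 'g \<times> 'g \<Rightarrow> 'g \<times> 'g \<Rightarrow> 'g \<Rightarrow> 'v"
  where "coboundary br rho f = (\<lambda>(x1, y1) (x2, y2) z.
    - f x2 (br x1 y1 y2) z - f (br x1 y1 x2) y2 z
    - f x2 y2 (br x1 y1 z) + f x1 y1 (br x2 y2 z)
    + rho x1 y1 (f x2 y2 z) - rho x2 y2 (f x1 y1 z)
    - rho y2 z (f x1 y1 x2) - rho z x2 (f x1 y1 y2))"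

definition coboundary_lam ::
  "('g \<Rightarrow> 'g \<Rightarrow> 'g \<Rightarrow> 'g) \<Rightarrow> 'k::field_char_0 \<Rightarrow> ('g \<Rightarrow> 'g) \<Rightarrow>
   ('k \<Rightarrow> 'v::ab_group_add \<Rightarrow> 'v) \<Rightarrow> ('g \<Rightarrow> 'g \<Rightarrow> 'v \<Rightarrow> 'v) \<Rightarrow>
   ('g \<Rightarrow> 'v) \<Rightarrow> 'g \<Rightarrow> 'g \<Rightarrow> 'g \<Rightarrow> 'v"
  where "coboundary_lam br lam d sv rho g x y z =
    - g (br x y z) + rho_hat lam d sv rho x y (g z)
    + rho_hat lam d sv rho y z (g x) + rho_hat lam d sv rho z x (g y)"

definition delta ::
  "'k::field_char_0 \<Rightarrow> ('g \<Rightarrow> 'g) \<Rightarrow> ('k \<Rightarrow> 'v::ab_group_add \<Rightarrow> 'v) \<Rightarrow> ('v \<Rightarrow> 'v) \<Rightarrow>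
   ('g \<Rightarrow> 'g \<Rightarrow> 'g \<Rightarrow> 'v) \<Rightarrow> 'g \<Rightarrow> 'g \<Rightarrow> 'g \<Rightarrow> 'v"
  where "delta lam d sv dV f x y z =
    f (d x) y z + f x (d y) z + f x y (d z)
    + sv lam (f (d x) (d y) z + f x (d y) (d z) + f (d x) y (d z))
    + sv (lam ^ 2) (f (d x) (d y) (d z)) - dV (f x y z)"

definition two_cochain ::
  "('k::field \<Rightarrow> 'g::ab_group_add \<Rightarrow> 'g) \<Rightarrow> ('k \<Rightarrow> 'v::ab_group_add \<Rightarrow> 'v) \<Rightarrow>
   ('g \<Rightarrow> 'g \<Rightarrow> 'g \<Rightarrow> 'v) \<Rightarrow> ('g \<Rightarrow> 'v) \<Rightarrow> bool"
  where "two_cochain sg sv f g \<longleftrightarrow>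
    trilinear_on sg sv f \<and> skew_symmetric3 f \<and> Vector_Spaces.linear sg sv g"

definition two_cocycle ::
  "('k::field_char_0 \<Rightarrow> 'g::ab_group_add \<Rightarrow> 'g) \<Rightarrow> ('g \<Rightarrow> 'g \<Rightarrow> 'g \<Rightarrow> 'g) \<Rightarrow> 'k \<Rightarrow> ('g \<Rightarrow> 'g) \<Rightarrow>
   ('k \<Rightarrow> 'v::ab_group_add \<Rightarrow> 'v) \<Rightarrow> ('g \<Rightarrow> 'g \<Rightarrow> 'v \<Rightarrow> 'v) \<Rightarrow> ('v \<Rightarrow> 'v) \<Rightarrow>
   ('g \<Rightarrow> 'g \<Rightarrow> 'g \<Rightarrow> 'v) \<Rightarrow> ('g \<Rightarrow> 'v) \<Rightarrow> bool"
  where "two_cocycle sg br lam d sv rho dV f g \<longleftrightarrow>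
    two_cochain sg sv f g \<and>
    (\<forall>X1 X2 z. coboundary br rho f X1 X2 z = 0) \<and>
    (\<forall>x y z. coboundary_lam br lam d sv rho g x y z + delta lam d sv dV f x y z = 0)"

text \<open>
  The direct sum of \<open>'g\<close> and \<open>'v\<close> is the product type, with the componentwise scalar
  multiplication \<^const>\<open>module_prod.scale\<close>; \<open>x + a\<close> is the pair \<open>(x, a)\<close>.
\<close>

definition twisted_bracket ::
  "('g \<Rightarrow> 'g \<Rightarrow> 'g \<Rightarrow> 'g) \<Rightarrow> ('g \<Rightarrow> 'g \<Rightarrow> 'v \<Rightarrow> 'v::ab_group_add) \<Rightarrow>
   ('g \<Rightarrow> 'g \<Rightarrow> 'g \<Rightarrow> 'v) \<Rightarrow> 'g \<times> 'v \<Rightarrow> 'g \<times> 'v \<Rightarrow> 'g \<times> 'v \<Rightarrow> 'g \<times> 'v"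
  where "twisted_bracket br rho psi = (\<lambda>(x, a) (y, b) (z, c).
    (br x y z, psi x y z + rho x y c + rho y z a + rho z x b))"

definition twisted_differential ::
  "('g \<Rightarrow> 'g) \<Rightarrow> ('v \<Rightarrow> 'v::ab_group_add) \<Rightarrow> ('g \<Rightarrow> 'v) \<Rightarrow> 'g \<times> 'v \<Rightarrow> 'g \<times> 'v"
  where "twisted_differential d dV chi = (\<lambda>(x, a). (d x, dV a + chi x))"

end

theory Submission
  imports Defs
begin

text \<open>
  On the extension, the \<open>'g\<close>-components of both axioms are the axioms of the base algebra, and
  the terms of the \<open>'v\<close>-components that involve elements of \<open>'v\<close> cancel by the axioms of the
  representation.  What remains of the fundamental identity is the coboundary of \<open>psi\<close>, and what
  remains of the Leibniz rule is the second cocycle expression, so each axiom holds exactly when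
  the corresponding cocycle condition does.
\<close>

lemma trilinear_onD:
  assumes "trilinear_on s t f"
  shows "f (x + x') y z = f x y z + f x' y z"
    and "f x (y + y') z = f x y z + f x y' z"
    and "f x y (z + z') = f x y z + f x y z'"
    and "f (s r x) y z = t r (f x y z)"
    and "f x (s r y) z = t r (f x y z)"
    and "f x y (s r z) = t r (f x y z)"
  using assms by (simp_all add: trilinear_on_def Vector_Spaces.linear_iff)

lemma bilinear_onD:
  assumes "bilinear_on s t f"
  shows "f (x + x') y = f x y + f x' y"
    and "f x (y + y') = f x y + f x y'"
    and "f (s r x) y = t r (f x y)"
    and "f x (s r y) = t r (f x y)"
  using assms by (simp_all add: bilinear_on_def Vector_Spaces.linear_iff)

context three_lie_representation
begin

sublocale prod: vector_space_prod sg sv ..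

lemma rho_add_right: "rho x y (v + w) = rho x y v + rho x y w"
  using rho_linear unfolding Vector_Spaces.linear_iff by metis

lemma rho_scale_right: "rho x y (sv r v) = sv r (rho x y v)"
  using rho_linear unfolding Vector_Spaces.linear_iff by metis

lemma trilinear_on_twisted_bracket:
  assumes "trilinear_on sg sv psi"
  shows "trilinear_on prod.scale prod.scale (twisted_bracket br rho psi)"
  using prod.p.vector_space_axioms
  unfolding trilinear_on_def Vector_Spaces.linear_iff
  by (auto simp: twisted_bracket_def prod.scale_prod trilinear_onD[OF br_trilinear]
      trilinear_onD[OF assms] bilinear_onD[OF rho_bilinear] rho_add_right rho_scale_right
      V.scale_right_distrib)

text \<open>The three \<open>rho\<close>-terms carry the pairs of \<open>'g\<close>-arguments in
  cyclic order. An adjacent transposition reverses that order, so it permutes these terms and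
  changes the sign of each.\<close>

lemma skew_symmetric3_twisted_bracket:
  assumes "skew_symmetric3 psi"
  shows "skew_symmetric3 (twisted_bracket br rho psi)"
proof -
  have br: "br y x z = - br x y z" "br x z y = - br x y z" for x y z
    using br_skew unfolding skew_symmetric3_def by blast+
  have psi: "psi y x z = - psi x y z" "psi x z y = - psi x y z" for x y z
    using assms unfolding skew_symmetric3_def by blast+
  have "twisted_bracket br rho psi (y, b) (x, a) (z, c) =
      - twisted_bracket br rho psi (x, a) (y, b) (z, c)" for x y z a b c
    \<comment> \<open>The instances of \<open>rho_skew\<close> are oriented towards the cyclic pairs
      \<open>x y\<close>, \<open>y z\<close>, \<open>z x\<close>.\<close>
    by (simp add: twisted_bracket_def br(1)[of x y z] psi(1)[of x y z] rho_skew[of y x]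
        rho_skew[of z y] rho_skew[of x z])
  moreover have "twisted_bracket br rho psi (x, a) (z, c) (y, b) =
      - twisted_bracket br rho psi (x, a) (y, b) (z, c)" for x y z a b c
    by (simp add: twisted_bracket_def br(2)[of x z y] psi(2)[of x z y] rho_skew[of y x]
        rho_skew[of z y] rho_skew[of x z])
  ultimately show ?thesis
    unfolding skew_symmetric3_def split_paired_All by blast
qed

text \<open>The terms in \<open>b1\<close>, \<open>b2\<close>, \<open>b3\<close> cancel by
  \<open>rho_rho\<close>, those in \<open>a1\<close>, \<open>a2\<close> by \<open>rho_br\<close>;
  the \<open>psi\<close>-terms left over are the coboundary. Stating the exact error term serves
  both directions of the equivalence.\<close>

lemma twisted_bracket_fundamental_defect:
  fixes psi :: "'g \<Rightarrow> 'g \<Rightarrow> 'g \<Rightarrow> 'v"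
  defines "B \<equiv> twisted_bracket br rho psi"
  shows "B (x1, a1) (x2, a2) (B (y1, b1) (y2, b2) (y3, b3)) =
      B (B (x1, a1) (x2, a2) (y1, b1)) (y2, b2) (y3, b3)
      + B (y1, b1) (B (x1, a1) (x2, a2) (y2, b2)) (y3, b3)
      + B (y1, b1) (y2, b2) (B (x1, a1) (x2, a2) (y3, b3))
      + (0, coboundary br rho psi (x1, x2) (y1, y2) y3)"
proof -
  have minus: "rho x y (- v) = - rho x y v" for x y v
    using rho_linear unfolding Vector_Spaces.linear_iff_module_hom by (rule module_hom.neg)
  \<comment> \<open>This is \<open>rho_br\<close> in cyclic form: swapping \<open>y1\<close> and
    \<open>y3\<close> absorbs its minus sign.\<close>
  have a1: "rho x2 (br y1 y2 y3) a1 =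
      rho y2 y3 (rho x2 y1 a1) + rho y3 y1 (rho x2 y2 a1) + rho y1 y2 (rho x2 y3 a1)"
    by (simp add: rho_br rho_skew[of y1 y3])
  \<comment> \<open>Moving \<open>x1\<close> to the first slot costs one sign outside and one inside
    each product; \<open>minus\<close> pulls the inner one out, and the two cancel.\<close>
  have a2: "rho (br y1 y2 y3) x1 a2 =
      rho y2 y3 (rho y1 x1 a2) + rho y3 y1 (rho y2 x1 a2) + rho y1 y2 (rho y3 x1 a2)"
    by (simp add: rho_skew[of "br y1 y2 y3" x1] rho_skew[of _ x1] rho_br rho_skew[of y1 y3] minus)
  show ?thesis
    by (simp add: B_def twisted_bracket_def coboundary_def rho_add_right
        fundamental_identity[of x1 x2 y1 y2 y3] a1 a2
        rho_rho[of x1 x2 y1 y2] rho_rho[of x1 x2 y2 y3] rho_rho[of x1 x2 y3 y1])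
qed

end

context differential_three_lie_representation
begin

lemma linear_twisted_differential:
  assumes "Vector_Spaces.linear sg sv chi"
  shows "Vector_Spaces.linear prod.scale prod.scale (twisted_differential d dV chi)"
  using prod.p.vector_space_axioms d_linear dV_linear assms
  unfolding Vector_Spaces.linear_iff
  by (auto simp: twisted_differential_def prod.scale_prod V.scale_right_distrib)

text \<open>In the \<open>'v\<close>-component, the terms containing \<open>chi x\<close> have
  coefficients 1, \<open>lam\<close>, \<open>lam\<close>, \<open>lam ^ 2\<close> and add up to
  \<open>rho_hat\<close> at \<open>y\<close>, \<open>z\<close>; likewise for \<open>chi y\<close>
  and \<open>chi z\<close>. The terms in \<open>a\<close>, \<open>b\<close>, \<open>c\<close> match
  by \<open>dV_rho\<close>, and the \<open>psi\<close>-terms form \<open>delta\<close>.\<close>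

lemma twisted_differential_leibniz_defect:
  fixes psi :: "'g \<Rightarrow> 'g \<Rightarrow> 'g \<Rightarrow> 'v" and chi :: "'g \<Rightarrow> 'v"
  defines "B \<equiv> twisted_bracket br rho psi" and "D \<equiv> twisted_differential d dV chi"
  shows "B (D (x, a)) (y, b) (z, c) + B (x, a) (D (y, b)) (z, c) + B (x, a) (y, b) (D (z, c))
      + prod.scale lam (B (D (x, a)) (D (y, b)) (z, c))
      + prod.scale lam (B (x, a) (D (y, b)) (D (z, c)))
      + prod.scale lam (B (D (x, a)) (y, b) (D (z, c)))
      + prod.scale (lam ^ 2) (B (D (x, a)) (D (y, b)) (D (z, c))) =
      D (B (x, a) (y, b) (z, c))
      + (0, coboundary_lam br lam d sv rho chi x y z + delta lam d sv dV psi x y z)"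
proof -
  have dV_add: "dV (v + w) = dV v + dV w" for v w
    using dV_linear unfolding Vector_Spaces.linear_iff by metis
  show ?thesis
    by (simp add: B_def D_def twisted_bracket_def twisted_differential_def coboundary_lam_def
        delta_def rho_hat_def prod.scale_prod d_bracket dV_add dV_rho rho_add_right
        V.scale_right_distrib power2_eq_square)
qed

lemma differential_three_lie_algebra_twisted_iff:
  assumes "trilinear_on sg sv psi" and "skew_symmetric3 psi"
    and "Vector_Spaces.linear sg sv chi"
  shows "differential_three_lie_algebra prod.scale (twisted_bracket br rho psi) lam
           (twisted_differential d dV chi)
         \<longleftrightarrow> two_cocycle sg br lam d sv rho dV psi chi"
    (is "?L \<longleftrightarrow> ?R")
proof
  assume ?L
  then interpret E: differential_three_lie_algebra prod.scale "twisted_bracket br rho psi" lam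
    "twisted_differential d dV chi" .
  have "coboundary br rho psi (x1, x2) (y1, y2) y3 = 0" for x1 x2 y1 y2 y3
    \<comment> \<open>The defect depends only on the \<open>'g\<close>-components, so zero
      \<open>'v\<close>-components suffice to isolate it.\<close>
    using twisted_bracket_fundamental_defect[of psi x1 0 x2 0 y1 0 y2 0 y3 0]
      E.fundamental_identity[of "(x1, 0)" "(x2, 0)" "(y1, 0)" "(y2, 0)" "(y3, 0)"]
    by (simp add: zero_prod_def)
  moreover have "coboundary_lam br lam d sv rho chi x y z + delta lam d sv dV psi x y z = 0"
    for x y z
    using twisted_differential_leibniz_defect[of psi chi x 0 y 0 z 0]
    by (simp add: E.d_bracket zero_prod_def)
  ultimately show ?R
    using assms by (auto simp: two_cocycle_def two_cochain_def)
next
  assume ?R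
  then have psi: "coboundary br rho psi (x1, x2) (y1, y2) y3 = 0"
    and chi: "coboundary_lam br lam d sv rho chi x y z + delta lam d sv dV psi x y z = 0"
    for x1 x2 y1 y2 y3 x y z
    unfolding two_cocycle_def by blast+
  \<comment> \<open>With linearity registered here, \<open>unfold_locales\<close> leaves only the
    conditions on the bracket and the Leibniz rule.\<close>
  interpret D: Vector_Spaces.linear prod.scale prod.scale "twisted_differential d dV chi"
    by (rule linear_twisted_differential) fact
  show ?L
  proof unfold_locales
    show "trilinear_on prod.scale prod.scale (twisted_bracket br rho psi)"
      by (rule trilinear_on_twisted_bracket) fact
    show "skew_symmetric3 (twisted_bracket br rho psi)"
      by (rule skew_symmetric3_twisted_bracket) fact
  next
    fix u1 u2 v1 v2 v3
    show "twisted_bracket br rho psi u1 u2 (twisted_bracket br rho psi v1 v2 v3) =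
        twisted_bracket br rho psi (twisted_bracket br rho psi u1 u2 v1) v2 v3
        + twisted_bracket br rho psi v1 (twisted_bracket br rho psi u1 u2 v2) v3
        + twisted_bracket br rho psi v1 v2 (twisted_bracket br rho psi u1 u2 v3)"
      \<comment> \<open>Projections split arbitrary elements into pairs; by \<open>psi\<close> the
        error term is \<open>(0, 0)\<close>, which is folded back to the zero of the
        product.\<close>
      using twisted_bracket_fundamental_defect[of psi "fst u1" "snd u1" "fst u2" "snd u2"
          "fst v1" "snd v1" "fst v2" "snd v2" "fst v3" "snd v3"]
      by (simp add: psi flip: zero_prod_def)
  next
    fix u v w
    show "twisted_differential d dV chi (twisted_bracket br rho psi u v w) =
        twisted_bracket br rho psi (twisted_differential d dV chi u) v w
        + twisted_bracket br rho psi u (twisted_differential d dV chi v) w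
        + twisted_bracket br rho psi u v (twisted_differential d dV chi w)
        + prod.scale lam (twisted_bracket br rho psi (twisted_differential d dV chi u)
            (twisted_differential d dV chi v) w)
        + prod.scale lam (twisted_bracket br rho psi u (twisted_differential d dV chi v)
            (twisted_differential d dV chi w))
        + prod.scale lam (twisted_bracket br rho psi (twisted_differential d dV chi u) v
            (twisted_differential d dV chi w))
        + prod.scale (lam ^ 2) (twisted_bracket br rho psi (twisted_differential d dV chi u)
            (twisted_differential d dV chi v) (twisted_differential d dV chi w))"
      using twisted_differential_leibniz_defect[of psi chi "fst u" "snd u" "fst v" "snd v"
          "fst w" "snd w"]
      by (simp add: chi flip: zero_prod_def)
  qed
qed

end

theorem proposition5p4:
  fixes sg :: "'k::field_char_0 \<Rightarrow> 'g::ab_group_add \<Rightarrow> 'g"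
    and br :: "'g \<Rightarrow> 'g \<Rightarrow> 'g \<Rightarrow> 'g"
    and lam :: 'k
    and d :: "'g \<Rightarrow> 'g"
    and sv :: "'k \<Rightarrow> 'v::ab_group_add \<Rightarrow> 'v"
    and rho :: "'g \<Rightarrow> 'g \<Rightarrow> 'v \<Rightarrow> 'v"
    and dV :: "'v \<Rightarrow> 'v"
    and psi :: "'g \<Rightarrow> 'g \<Rightarrow> 'g \<Rightarrow> 'v"
    and chi :: "'g \<Rightarrow> 'v"
  assumes "differential_three_lie_algebra sg br lam d"
    and "differential_three_lie_representation sg br lam d sv rho dV"
    and "trilinear_on sg sv psi" and "skew_symmetric3 psi"
    and "Vector_Spaces.linear sg sv chi"
  shows "differential_three_lie_algebra (module_prod.scale sg sv)
           (twisted_bracket br rho psi) lam (twisted_differential d dV chi)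
         \<longleftrightarrow> two_cocycle sg br lam d sv rho dV psi chi"
  using assms(2-5)
  by (rule differential_three_lie_representation.differential_three_lie_algebra_twisted_iff)

end
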